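(* Let $G$ be a left-compressed $3$-graph on the vertex set $[t]$ that does not contain a clique of order $\lfloor \frac{t-2}{2}\rfloor$. Then $$\lambda(G)\le \frac{1}{6}\,\frac{(t-3)^2}{(t-2)(t-1)}<\lambda([t-1]^{(3)}).$$
   Context: A $3$-graph $G$ on vertex set $[t]=\{1,\dots,t\}$ has an edge set $E$ of $3$-element subsets of $[t]$; an edge $\{a,b,c\}$ is written $abc$. $G$ is left-compressed if whenever $j_1j_2j_3\in E$ and $i_1,i_2,i_3$ are distinct with $i_p\le j_p$ for $p=1,2,3$, then $i_1i_2i_3\in E$. A clique of order $s$ is a set of $s$ vertices all of whose $3$-subsets are edges. $[t-1]^{(3)}$ is the complete $3$-graph on $[t-1]$. For $\vec x\in\mathbb R^t$, $\lambda(G,\vec x)=\sum_{ijk\in E}x_ix_jx_k$, and the Lagrangian is $\lambda(G)=\max\{\lambda(G,\vec x):\sum_i x_i=1,\ x_i\ge0\}$. *)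

theory Defs
  imports "HOL-Analysis.Analysis" "HOL-Library.Ramsey"
begin

text \<open>A 3-graph on the vertex set \<open>{1..t}\<close> is given by its edge set; \<open>nsets V 3\<close>
  is the set of all 3-element subsets of \<open>V\<close>.\<close>

definition three_graph :: "nat \<Rightarrow> nat set set \<Rightarrow> bool" where
  "three_graph t E \<longleftrightarrow> E \<subseteq> nsets {1..t} 3"

abbreviation complete_three_graph :: "nat \<Rightarrow> nat set set" where
  "complete_three_graph t \<equiv> nsets {1..t} 3"

text \<open>The lower bound \<open>1\<close> on the \<open>i\<close>'s keeps them in the vertex set \<open>{1..t}\<close>; the
  \<open>j\<close>'s are automatically distinct when \<open>E\<close> consists of 3-element sets.\<close>

definition left_compressed :: "nat set set \<Rightarrow> bool" where
  "left_compressed E \<longleftrightarrow>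
    (\<forall>i1 i2 i3 j1 j2 j3. {j1, j2, j3} \<in> E
      \<and> 1 \<le> i1 \<and> 1 \<le> i2 \<and> 1 \<le> i3 \<and> i1 \<noteq> i2 \<and> i1 \<noteq> i3 \<and> i2 \<noteq> i3
      \<and> i1 \<le> j1 \<and> i2 \<le> j2 \<and> i3 \<le> j3 \<longrightarrow> {i1, i2, i3} \<in> E)"

text \<open>Sets of at most two vertices, including the empty set, are vacuously cliques.\<close>

definition has_clique :: "nat \<Rightarrow> nat set set \<Rightarrow> nat \<Rightarrow> bool" where
  "has_clique t E s \<longleftrightarrow> (\<exists>S. S \<subseteq> {1..t} \<and> card S = s \<and> nsets S 3 \<subseteq> E)"

text \<open>Weight vectors are functions on \<open>nat\<close> of which only the coordinates in \<open>{1..t}\<close> matter.\<close>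

definition weight_poly :: "nat set set \<Rightarrow> (nat \<Rightarrow> real) \<Rightarrow> real" where
  "weight_poly E x = (\<Sum>e\<in>E. \<Prod>i\<in>e. x i)"

definition weightings :: "nat \<Rightarrow> (nat \<Rightarrow> real) set" where
  "weightings t = {x. (\<forall>i\<in>{1..t}. 0 \<le> x i) \<and> (\<Sum>i=1..t. x i) = 1}"

text \<open>The supremum is a maximum for \<open>t \<ge> 1\<close>, see \<open>lagrangian_is_max\<close> below;
  for \<open>t = 0\<close> there are no weightings.\<close>

definition lagrangian :: "nat \<Rightarrow> nat set set \<Rightarrow> real" where
  "lagrangian t E = (SUP x\<in>weightings t. weight_poly E x)"

lemma lagrangian_is_max:
  assumes "three_graph t E" "1 \<le> t"
  shows "\<exists>x\<in>weightings t. weight_poly E x = lagrangian t E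
           \<and> (\<forall>y\<in>weightings t. weight_poly E y \<le> lagrangian t E)"
proof -
  let ?B = "PiE UNIV (\<lambda>i::nat. if i \<in> {1..t} then {0..1::real} else {0})"
  let ?H = "{x::nat \<Rightarrow> real. (\<Sum>i=1..t. x i) = 1}"
  define K where "K = ?B \<inter> ?H"
  have cont: "continuous_on UNIV (\<lambda>x::nat \<Rightarrow> real. x i)" for i
    by (rule continuous_on_product_coordinates)
  have "compactin (product_topology (\<lambda>i::nat. euclidean) UNIV) ?B"
    by (subst compactin_PiE) auto
  then have "compact ?B"
    by (simp add: euclidean_product_topology)
  moreover have "closed ?H"
    by (intro closed_Collect_eq continuous_on_sum cont continuous_on_const)
  ultimately have "compact K"
    unfolding K_def by (rule compact_Int_closed)
  have "(\<lambda>i. if i = 1 then 1 else 0) \<in> K"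
    using assms(2) by (auto simp: K_def)
  then have "K \<noteq> {}" by blast
  have "continuous_on K (weight_poly E)"
    unfolding weight_poly_def
    by (intro continuous_on_sum continuous_on_prod continuous_on_subset[OF cont]) auto
  from continuous_attains_sup[OF \<open>compact K\<close> \<open>K \<noteq> {}\<close> this]
  obtain x where x: "x \<in> K" "\<And>y. y \<in> K \<Longrightarrow> weight_poly E y \<le> weight_poly E x"
    by blast
  have xW: "x \<in> weightings t"
    using x(1) by (auto simp: K_def weightings_def PiE_iff split: if_splits)
  have le: "weight_poly E y \<le> weight_poly E x" if y: "y \<in> weightings t" for y
  proof -
    define z where "z = (\<lambda>i. if i \<in> {1..t} then y i else 0)"
    have "y i \<le> 1" if "i \<in> {1..t}" for i
    proof -
      have "y i \<le> (\<Sum>i=1..t. y i)"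
        using y that by (intro member_le_sum) (auto simp: weightings_def)
      then show ?thesis using y by (simp add: weightings_def)
    qed
    moreover have "(\<Sum>i=1..t. z i) = (\<Sum>i=1..t. y i)"
      by (rule sum.cong) (auto simp: z_def)
    ultimately have "z \<in> K"
      using y by (auto simp: K_def weightings_def z_def)
    moreover have "weight_poly E z = weight_poly E y"
      unfolding weight_poly_def
    proof (intro sum.cong prod.cong refl)
      fix e i assume "e \<in> E" "i \<in> e"
      then have "i \<in> {1..t}"
        using assms(1) unfolding three_graph_def nsets_def by blast
      then show "z i = y i" by (simp add: z_def)
    qed
    ultimately show ?thesis using x(2) by metis
  qed
  have "lagrangian t E = weight_poly E x"
    unfolding lagrangian_def using xW le by (intro cSup_eq_maximum) auto
  then show ?thesis using xW le by auto
qed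

end

theory Submission
  imports Defs
begin

text \<open>If a left-compressed graph has no clique of order \<open>s\<close>, then every edge meets
  \<open>A = {1..s - 3}\<close>. So the weight polynomial is at most
  \<open>e\<^sub>3({1..t}) - e\<^sub>3({1..t} - A)\<close>, where \<open>e\<^sub>3\<close> is the third elementary symmetric
  function. By Newton's identities six times this difference is at most
  \<open>1 - q ^ 3 - (\<Sum>i\<in>A. 3 * x i ^ 2 - 2 * x i ^ 3)\<close> with \<open>q\<close> the weight outside \<open>A\<close>.
  Since \<open>2 * card A + 8 \<le> t\<close>, it suffices that the subtracted terms are at least
  \<open>3 / (2 * card A + 7)\<close>. A single \<open>x i \<ge> 2/5\<close> in \<open>A\<close> contributes enough; otherwise
  \<open>3 * x i ^ 2 - 2 * x i ^ 3 \<ge> 11/5 * x i ^ 2\<close> on \<open>A\<close>, and the Cauchy-Schwarz inequality leaves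
  an inequality in \<open>q\<close> and \<open>card A\<close>.\<close>

section \<open>Elementary symmetric functions through power sums\<close>

lemma nsets_insert:
  assumes "finite S" "v \<notin> S"
  shows "nsets (insert v S) (Suc k) = nsets S (Suc k) \<union> insert v ` nsets S k"
proof (intro equalityI subsetI)
  fix e assume e: "e \<in> nsets (insert v S) (Suc k)"
  show "e \<in> nsets S (Suc k) \<union> insert v ` nsets S k"
  proof (cases "v \<in> e")
    case True
    then have "e = insert v (e - {v})" by auto
    moreover have "e - {v} \<in> nsets S k"
      using e True by (auto simp: nsets_def)
    ultimately show ?thesis by blast
  next
    case False
    then show ?thesis using e by (auto simp: nsets_def)
  qed
next
  fix e assume "e \<in> nsets S (Suc k) \<union> insert v ` nsets S k"
  then show "e \<in> nsets (insert v S) (Suc k)"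
    using assms by (auto simp: nsets_def card_insert_if)
qed

lemma weight_poly_nsets_insert:
  assumes "finite S" "v \<notin> S"
  shows "weight_poly (nsets (insert v S) (Suc k)) x
           = weight_poly (nsets S (Suc k)) x + x v * weight_poly (nsets S k) x"
proof -
  have vn: "v \<notin> e" "finite e" if "e \<in> nsets S k" for e
    using that assms by (auto simp: nsets_def)
  have "inj_on (insert v) (nsets S k)"
    using vn(1) by (meson inj_onI insert_ident)
  then have "weight_poly (insert v ` nsets S k) x = (\<Sum>e\<in>nsets S k. \<Prod>i\<in>insert v e. x i)"
    unfolding weight_poly_def by (simp add: sum.reindex)
  also have "\<dots> = x v * weight_poly (nsets S k) x"
    unfolding weight_poly_def sum_distrib_left using vn by (intro sum.cong) auto
  finally have "weight_poly (insert v ` nsets S k) x = x v * weight_poly (nsets S k) x" .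
  moreover have "nsets S (Suc k) \<inter> insert v ` nsets S k = {}"
    using assms by (auto simp: nsets_def)
  ultimately show ?thesis
    using assms unfolding nsets_insert[OF assms]
    by (simp add: weight_poly_def sum.union_disjoint finite_imp_finite_nsets)
qed

lemma weight_poly_nsets_1: "weight_poly (nsets S (Suc 0)) x = sum x S"
  by (simp add: weight_poly_def nsets_one sum.reindex)

lemma weight_poly_nsets_2:
  assumes "finite S"
  shows "2 * weight_poly (nsets S (Suc (Suc 0))) x = (sum x S)\<^sup>2 - (\<Sum>i\<in>S. (x i)\<^sup>2)"
  using assms
proof (induction S)
  case empty
  then show ?case by (simp add: nsets_eq_empty weight_poly_def)
next
  case (insert v S)
  then show ?case
    by (simp add: weight_poly_nsets_insert weight_poly_nsets_1 power2_eq_square algebra_simps)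
qed

lemma weight_poly_nsets_3:
  assumes "finite S"
  shows "6 * weight_poly (nsets S 3) x
           = (sum x S) ^ 3 - 3 * sum x S * (\<Sum>i\<in>S. (x i)\<^sup>2) + 2 * (\<Sum>i\<in>S. (x i) ^ 3)"
  using assms
proof (induction S)
  case empty
  then show ?case by (simp add: nsets_eq_empty weight_poly_def)
next
  case (insert v S)
  have "6 * weight_poly (nsets (insert v S) 3) x
      = 6 * weight_poly (nsets S 3) x + 3 * x v * (2 * weight_poly (nsets S (Suc (Suc 0))) x)"
    using insert.hyps by (simp add: weight_poly_nsets_insert numeral_3_eq_3)
  also have "\<dots> = (sum x S) ^ 3 - 3 * sum x S * (\<Sum>i\<in>S. (x i)\<^sup>2) + 2 * (\<Sum>i\<in>S. (x i) ^ 3)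
      + 3 * x v * ((sum x S)\<^sup>2 - (\<Sum>i\<in>S. (x i)\<^sup>2))"
    using insert by (simp add: weight_poly_nsets_2)
  finally show ?case
    using insert.hyps by (simp add: power2_eq_square power3_eq_cube algebra_simps)
qed

section \<open>Cliques forced by compression\<close>

text \<open>An edge with all vertices at least \<open>s - 2\<close> dominates
  \<open>{s - 2, s - 1, s}\<close> coordinatewise, hence every triple in \<open>{1..s}\<close>;
  compression would then make \<open>{1..s}\<close> a clique.\<close>

lemma left_compressed_no_clique:
  assumes "left_compressed E" "\<not> has_clique t E s" "s \<le> t" "3 \<le> s"
    and "e \<in> E" "card e = 3"
  shows "\<exists>i\<in>e. i \<le> s - 3"
proof (rule ccontr)
  assume "\<not> (\<exists>i\<in>e. i \<le> s - 3)"
  then have far: "\<And>i. i \<in> e \<Longrightarrow> s - 2 \<le> i" using assms(4) by force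
  have "finite e" using assms(6) by (intro card_ge_0_finite) simp
  then have "e \<in> nsets UNIV 3" using assms(6) by (simp add: nsets_def)
  then obtain j1 j2 j3 where j: "e = {j1, j2, j3}" "j1 < j2" "j2 < j3"
    by (auto simp: ordered_nsets_3_eq)
  have "s - 2 \<le> j1" using far j(1) by simp
  have "nsets {1..s} 3 \<subseteq> E"
  proof
    fix f assume f: "f \<in> nsets {1..s} 3"
    then obtain i1 i2 i3 where i: "f = {i1, i2, i3}" "i1 < i2" "i2 < i3" "1 \<le> i1" "i3 \<le> s"
      by (auto simp: ordered_nsets_3_eq)
    then have "i1 \<le> j1" "i2 \<le> j2" "i3 \<le> j3"
      using \<open>s - 2 \<le> j1\<close> i j by linarith+
    then show "f \<in> E"
      using assms(1)[unfolded left_compressed_def, rule_format, of j1 j2 j3 i1 i2 i3]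
        assms(5) i j by simp
  qed
  then have "has_clique t E s"
    unfolding has_clique_def using assms(3) by (intro exI[of _ "{1..s}"]) auto
  with assms(2) show False by simp
qed

section \<open>Real inequalities for the deficit\<close>

text \<open>Here \<open>a\<close> stands for \<open>card A\<close> and \<open>q\<close> for the
  weight outside \<open>A\<close>. The factor \<open>11 / (5 * a)\<close> is the \<open>11/5\<close>
  of the quadratic bound divided by \<open>a\<close> through Cauchy-Schwarz. The quadratic minorant
  of the cube takes negative values, which is too lossy when \<open>a\<close> is large, so large
  \<open>a\<close> is treated apart.\<close>

lemma cube_plus_square_ge:
  fixes a q :: real
  assumes "1 \<le> a" "0 \<le> q" "q \<le> 1"
  shows "3 / (2 * a + 7) \<le> q ^ 3 + 11 / (5 * a) * (1 - q)\<^sup>2"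
proof -
  define c where "c = 11 / (5 * a)"
  define d where "d = 3 / (2 * a + 7)"
  have "c > 0" using assms by (simp add: c_def)
  have "d \<le> q ^ 3 + c * (1 - q)\<^sup>2"
  proof (cases "a \<le> 200")
    case True
    \<comment> \<open>\<open>q * (q - 1/4)\<^sup>2 \<ge> 0\<close> bounds the cube below by a quadratic polynomial, and the
      resulting quadratic inequality in \<open>q\<close> holds because its discriminant is negative.\<close>
    have disc: "(1/16 + 2 * c)\<^sup>2 \<le> 4 * (1/2 + c) * (c - d)"
    proof -
      have "a * (a * a) \<le> 200 * (a * a)"
        using True by (intro mult_right_mono) auto
      moreover have "0 \<le> a * a" by simp
      \<comment> \<open>The next inequality cleared of denominators, with a spare factor
        \<open>2 * a + 7\<close>. The cubic term is absorbed since
        \<open>100 * 200 < 21060\<close>.\<close>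
      ultimately have "a * (a * (a * 100)) \<le> 24640 + (a * (a * 21060) + a * 81975)"
        using assms(1) by linarith
      then have "1/256 + c / 4 + 2 * d + 4 * c * d \<le> 2 * c"
        unfolding c_def d_def using assms(1)
        by (simp add: divide_simps) (simp add: algebra_simps)
      then show ?thesis by (simp add: power2_eq_square algebra_simps)
    qed
    have "0 \<le> (2 * (1/2 + c) * q - (1/16 + 2 * c))\<^sup>2
        + (4 * (1/2 + c) * (c - d) - (1/16 + 2 * c)\<^sup>2)"
      using disc by simp
    also have "\<dots> = 4 * (1/2 + c) * ((1/2 + c) * q\<^sup>2 - (1/16 + 2 * c) * q + (c - d))"
      by (simp add: power2_eq_square algebra_simps)
    finally have "0 \<le> (1/2 + c) * q\<^sup>2 - (1/16 + 2 * c) * q + (c - d)"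
      using \<open>c > 0\<close> by (simp add: zero_le_mult_iff)
    moreover have "0 \<le> q * (q - 1/4)\<^sup>2" using assms by simp
    ultimately show ?thesis
      by (simp add: power2_eq_square power3_eq_cube algebra_simps)
  next
    case False
    show ?thesis
    proof (cases "q \<le> 1/6")
      case True
      \<comment> \<open>The square term alone suffices, because
        \<open>11/5 * (5/6)^2 = 55/36\<close> exceeds \<open>3/2\<close>.\<close>
      have "d \<le> c * (5/6)\<^sup>2"
        unfolding c_def d_def using assms(1)
        by (simp add: power2_eq_square divide_simps)
      also have "\<dots> \<le> c * (1 - q)\<^sup>2"
        using True \<open>c > 0\<close> by (intro mult_left_mono power_mono) auto
      finally show ?thesis using assms by (simp add: add_increasing)
    next
      case q: False
      have "d * (1 / c + 6) \<le> 1"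
        unfolding c_def d_def using False by (simp add: divide_simps)
      then have "d * (1 + 6 * c) \<le> c"
        using \<open>c > 0\<close> by (simp add: field_simps)
      \<comment> \<open>With \<open>q ^ 3\<close> replaced by \<open>q^2 / 6\<close>, the minimum
        over \<open>q\<close> is \<open>c / (1 + 6 * c)\<close>, attained at
        \<open>q = 6 * c * (1 - q)\<close>.\<close>
      moreover have "c \<le> (1 + 6 * c) * (q\<^sup>2 / 6 + c * (1 - q)\<^sup>2)"
      proof -
        have "(1 + 6 * c) * (q\<^sup>2 / 6 + c * (1 - q)\<^sup>2) - c = (q - 6 * c * (1 - q))\<^sup>2 / 6"
          by (simp add: power2_eq_square field_simps)
        then show ?thesis using zero_le_power2[of "q - 6 * c * (1 - q)"] by linarith
      qed
      ultimately have "d * (1 + 6 * c) \<le> (q\<^sup>2 / 6 + c * (1 - q)\<^sup>2) * (1 + 6 * c)"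
        by (simp add: mult.commute)
      then have "d \<le> q\<^sup>2 / 6 + c * (1 - q)\<^sup>2"
        using \<open>c > 0\<close> by (subst (asm) mult_le_cancel_right) auto
      moreover have "q\<^sup>2 / 6 \<le> q ^ 3"
        using mult_right_mono[of "1/6" q "q\<^sup>2"] q by (simp add: power2_eq_square power3_eq_cube)
      ultimately show ?thesis by simp
    qed
  qed
  then show ?thesis by (simp add: c_def d_def)
qed

lemma weight_deficit_ge:
  fixes x :: "'a \<Rightarrow> real"
  assumes "finite A" "\<And>i. i \<in> A \<Longrightarrow> 0 \<le> x i" "sum x A \<le> 1"
  shows "3 / (2 * real (card A) + 7)
    \<le> (1 - sum x A) ^ 3 + (\<Sum>i\<in>A. 3 * (x i)\<^sup>2 - 2 * (x i) ^ 3)"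
proof (cases "A = {}")
  case True
  then show ?thesis by simp
next
  case False
  define a where "a = real (card A)"
  have "a \<ge> 1"
    using False assms(1) by (simp add: a_def Suc_le_eq card_gt_0_iff)
  have le1: "x i \<le> 1" if "i \<in> A" for i
    using member_le_sum[of i A x] that assms by fastforce
  have factor: "3 * y\<^sup>2 - 2 * y ^ 3 = y\<^sup>2 * (3 - 2 * y)" for y :: real
    by (simp add: power2_eq_square power3_eq_cube algebra_simps)
  have nonneg: "0 \<le> 3 * (x i)\<^sup>2 - 2 * (x i) ^ 3" if "i \<in> A" for i
    unfolding factor using le1[OF that] by simp
  show ?thesis
  \<comment> \<open>At \<open>2/5\<close> the increasing function \<open>3 * y^2 - 2 * y^3\<close>
    on \<open>[0, 1]\<close> equals \<open>44/125\<close>, just above \<open>1/3\<close>, the bound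
    for \<open>3 / (2 * a + 7)\<close> when \<open>a >= 1\<close>. Below \<open>2/5\<close> the
    factor \<open>3 - 2 * y\<close> exceeds \<open>11/5\<close>.\<close>
  proof (cases "\<exists>i\<in>A. 2/5 \<le> x i")
    case True
    then obtain i where i: "i \<in> A" "2/5 \<le> x i" by blast
    have "3 / (2 * a + 7) \<le> 1/3"
      using \<open>a \<ge> 1\<close> by (simp add: divide_simps)
    also have "1/3 \<le> 3 * (x i)\<^sup>2 - 2 * (x i) ^ 3"
    proof -
      have "3 * (x i)\<^sup>2 - 2 * (x i) ^ 3 - 44/125
          = (x i - 2/5) * (2 * (x i * (1 - x i)) + x i / 5 + 22/25)"
        by (simp add: power2_eq_square power3_eq_cube field_simps)
      also have "\<dots> \<ge> 0"
        using i le1[OF i(1)] by (intro mult_nonneg_nonneg add_nonneg_nonneg) auto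
      finally show ?thesis by simp
    qed
    also have "\<dots> \<le> (\<Sum>i\<in>A. 3 * (x i)\<^sup>2 - 2 * (x i) ^ 3)"
      using i nonneg assms(1) by (intro member_le_sum) auto
    finally show ?thesis using assms(3) by (simp add: a_def add_increasing)
  next
    case False
    have "(sum x A)\<^sup>2 / a \<le> (\<Sum>i\<in>A. (x i)\<^sup>2)"
      using sum_squared_le_sum_of_squares[of x A] \<open>a \<ge> 1\<close>
      by (simp add: a_def divide_simps)
    then have "11 / (5 * a) * (sum x A)\<^sup>2 \<le> 11/5 * (\<Sum>i\<in>A. (x i)\<^sup>2)"
      by (simp add: field_simps)
    also have "\<dots> \<le> (\<Sum>i\<in>A. 3 * (x i)\<^sup>2 - 2 * (x i) ^ 3)"
      unfolding sum_distrib_left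
    proof (rule sum_mono)
      fix i assume "i \<in> A"
      then have "(x i)\<^sup>2 * (11/5) \<le> (x i)\<^sup>2 * (3 - 2 * x i)"
        using False by (intro mult_left_mono) (auto simp: not_le)
      then show "11/5 * (x i)\<^sup>2 \<le> 3 * (x i)\<^sup>2 - 2 * (x i) ^ 3"
        unfolding factor by simp
    qed
    finally show ?thesis
      using cube_plus_square_ge[of a "1 - sum x A"] \<open>a \<ge> 1\<close> assms(3) sum_nonneg[of A x] assms(2)
      unfolding a_def by simp
  qed
qed

section \<open>Graphs whose edges all meet a fixed set\<close>

lemma weight_poly_le_of_covered:
  assumes "three_graph t E" "x \<in> weightings t" "A \<subseteq> {1..t}"
    and cover: "\<And>e. e \<in> E \<Longrightarrow> e \<inter> A \<noteq> {}"
  shows "6 * weight_poly E x \<le> 1 - 3 / (2 * real (card A) + 7)"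
proof -
  define B where "B = {1..t} - A"
  have x: "\<And>i. i \<in> {1..t} \<Longrightarrow> 0 \<le> x i" "sum x {1..t} = 1"
    using assms(2) by (auto simp: weightings_def)
  have fin: "finite A" "finite B" using assms(3) by (auto simp: B_def finite_subset)
  have split: "sum f {1..t} = sum f A + sum f B" for f :: "nat \<Rightarrow> real"
    using sum.subset_diff[OF assms(3), of f] by (simp add: B_def)
  have sub: "nsets B 3 \<subseteq> nsets {1..t} 3"
    by (auto simp: nsets_def B_def)
  have "E \<subseteq> nsets {1..t} 3 - nsets B 3"
    using assms(1) cover unfolding three_graph_def nsets_def B_def by blast
  then have "weight_poly E x \<le> weight_poly (nsets {1..t} 3 - nsets B 3) x"
    unfolding weight_poly_def using x(1)
    by (intro sum_mono2 finite_Diff finite_imp_finite_nsets prod_nonneg)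
      (auto simp: nsets_def)
  also have "\<dots> = weight_poly (nsets {1..t} 3) x - weight_poly (nsets B 3) x"
    unfolding weight_poly_def by (intro sum_diff sub finite_imp_finite_nsets) simp
  finally have "6 * weight_poly E x
      \<le> 6 * weight_poly (nsets {1..t} 3) x - 6 * weight_poly (nsets B 3) x" by simp
  \<comment> \<open>The cubes over \<open>B\<close> cancel, while the squares over \<open>B\<close>
    occur with factors \<open>1\<close> and \<open>sum x B\<close>, leaving
    \<open>sum x A\<close>.\<close>
  also have "\<dots> = 1 - (1 - sum x A) ^ 3 - (\<Sum>i\<in>A. 3 * (x i)\<^sup>2 - 2 * (x i) ^ 3)
      - 3 * sum x A * (\<Sum>i\<in>B. (x i)\<^sup>2)"
  proof -
    have sB: "sum x B = 1 - sum x A" using split[of x] x(2) by simp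
    then show ?thesis
      unfolding weight_poly_nsets_3[OF fin(2)] weight_poly_nsets_3[OF finite_atLeastAtMost]
        x(2) sB split[of "\<lambda>i. (x i)\<^sup>2"] split[of "\<lambda>i. (x i) ^ 3"] sum_subtractf
        sum_distrib_left[symmetric]
      by (simp add: algebra_simps)
  qed
  also have "\<dots> \<le> 1 - (1 - sum x A) ^ 3 - (\<Sum>i\<in>A. 3 * (x i)\<^sup>2 - 2 * (x i) ^ 3)"
    using x(1) assms(3) by (auto intro!: mult_nonneg_nonneg sum_nonneg)
  also have "\<dots> \<le> 1 - 3 / (2 * real (card A) + 7)"
    using weight_deficit_ge[of A x] fin x assms(3) split[of x] sum_nonneg[of B x]
    by (force simp: B_def)
  finally show ?thesis .
qed

section \<open>Comparison with the complete graph\<close>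

text \<open>The left side is six times the value at the uniform weighting.\<close>

lemma lagrangian_complete_ge:
  assumes "1 \<le> n"
  shows "1 - 3 / real n + 2 / (real n)\<^sup>2 \<le> 6 * lagrangian n (complete_three_graph n)"
proof -
  define x where "x = (\<lambda>i::nat. 1 / real n)"
  have "x \<in> weightings n" using assms by (simp add: weightings_def x_def)
  then have "6 * weight_poly (nsets {1..n} 3) x \<le> 6 * lagrangian n (complete_three_graph n)"
    using lagrangian_is_max[of n "nsets {1..n} 3"] assms by (auto simp: three_graph_def)
  moreover have "6 * weight_poly (nsets {1..n} 3) x = 1 - 3 / real n + 2 / (real n)\<^sup>2"
    using assms by (simp add: weight_poly_nsets_3 x_def power2_eq_square power3_eq_cube)
  ultimately show ?thesis by simp
qed

theorem theorem5:
  fixes t :: nat and E :: "nat set set"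
  assumes "three_graph t E"
    and "left_compressed E"
    and "\<not> has_clique t E (nat \<lfloor>(real t - 2) / 2\<rfloor>)"
  shows "lagrangian t E \<le> 1 / 6 * ((real t - 3)\<^sup>2 / ((real t - 2) * (real t - 1)))
    \<and> 1 / 6 * ((real t - 3)\<^sup>2 / ((real t - 2) * (real t - 1)))
        < lagrangian (t - 1) (complete_three_graph (t - 1))"
proof -
  define s where "s = nat \<lfloor>(real t - 2) / 2\<rfloor>"
  \<comment> \<open>For \<open>s < 3\<close> the set \<open>{1..s}\<close> is vacuously a clique, so
    the hypothesis excludes small \<open>t\<close>, including those where \<open>nat\<close>
    truncates a negative floor to \<open>0\<close>.\<close>
  have "3 \<le> s"
  proof (rule ccontr)
    assume s: "\<not> 3 \<le> s"
    have "s \<le> t" by (simp add: s_def nat_le_iff floor_le_iff)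
    moreover have "nsets {1..s} 3 \<subseteq> E"
      using s by (simp add: nsets_eq_empty)
    ultimately have "has_clique t E s"
      unfolding has_clique_def by (intro exI[of _ "{1..s}"]) auto
    then show False using assms(3) by (simp add: s_def)
  qed
  moreover have "real s \<le> (real t - 2) / 2"
    using \<open>3 \<le> s\<close> unfolding s_def by linarith
  then have "real (2 * s + 2) \<le> real t" by simp
  then have "2 * s + 2 \<le> t" by (simp only: of_nat_le_iff)
  ultimately have st: "2 * (s - 3) + 8 \<le> t" by linarith
  have "s \<le> t" using st by linarith
  have no_clique: "\<not> has_clique t E s" using assms(3) by (simp add: s_def)
  define T where "T = real t"
  define R where "R = (T - 3)\<^sup>2 / ((T - 2) * (T - 1))"
  have T: "8 \<le> T" "2 * real (s - 3) + 7 \<le> T - 1" using st by (auto simp: T_def)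
  have "6 * weight_poly E x \<le> R" if "x \<in> weightings t" for x
  proof -
    have "e \<inter> {1..s - 3} \<noteq> {}" if "e \<in> E" for e
    proof -
      have "e \<subseteq> {1..t}" "card e = 3"
        using that assms(1) by (auto simp: three_graph_def nsets_def)
      moreover from this obtain i where "i \<in> e" "i \<le> s - 3"
        using left_compressed_no_clique[OF assms(2) no_clique \<open>s \<le> t\<close> \<open>3 \<le> s\<close> \<open>e \<in> E\<close>]
        by blast
      ultimately show ?thesis by fastforce
    qed
    then have "6 * weight_poly E x \<le> 1 - 3 / (2 * real (s - 3) + 7)"
      using weight_poly_le_of_covered[OF assms(1) \<open>x \<in> weightings t\<close>, of "{1..s - 3}"] st
      by simp
    also have "\<dots> \<le> 1 - 3 / (T - 1)"
      using T by (simp add: frac_le)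
    \<comment> \<open>The difference is \<open>1 / ((T - 2) * (T - 1))\<close>, since
      \<open>(T - 3)^2 - (T - 4) * (T - 2) = 1\<close>.\<close>
    also have "\<dots> \<le> R"
      unfolding R_def using T by (simp add: divide_simps power2_eq_square) (simp add: algebra_simps)
    finally show ?thesis .
  qed
  moreover obtain x where "x \<in> weightings t" "weight_poly E x = lagrangian t E"
    using lagrangian_is_max[OF assms(1)] st by auto
  ultimately have "6 * lagrangian t E \<le> R" by metis
  moreover have "R < 1 - 3 / (T - 1) + 2 / (T - 1)\<^sup>2"
  proof -
    have "(T - 3)\<^sup>2 * (T - 1) < (T - 3) * (T - 2)\<^sup>2"
    proof -
      \<comment> \<open>The second factor equals \<open>1\<close>.\<close>
      have "0 < (T - 3) * ((T - 2)\<^sup>2 - (T - 3) * (T - 1))"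
        using T by (intro mult_pos_pos) (auto simp: power2_eq_square algebra_simps)
      then show ?thesis by (simp add: power2_eq_square algebra_simps)
    qed
    then have "R < (T - 3) * (T - 2) / (T - 1)\<^sup>2"
      unfolding R_def using T by (simp add: divide_simps power2_eq_square mult_ac)
    also have "\<dots> = 1 - 3 / (T - 1) + 2 / (T - 1)\<^sup>2"
      using T by (simp add: divide_simps power2_eq_square) (simp add: algebra_simps)
    finally show ?thesis .
  qed
  moreover have "1 - 3 / (T - 1) + 2 / (T - 1)\<^sup>2
      \<le> 6 * lagrangian (t - 1) (complete_three_graph (t - 1))"
    using lagrangian_complete_ge[of "t - 1"] st by (simp add: T_def of_nat_diff)
  ultimately show ?thesis unfolding T_def[symmetric] R_def[symmetric] by simp
qed

end
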